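(* Every matched pair of complex Lie algebras $(\mathfrak g_1,\mathfrak g_2)$ with $\mathfrak g_1=\mathfrak g_2=\mathbb{C}$ can be exponentiated to a matched pair of (complex) Lie groups $(G_1,G_2)$, where each of $G_1,G_2$ is either $(\mathbb{C},+)$ or $(\mathbb{C}\setminus\{0\},\cdot)$. Every matched pair of real Lie algebras $(\mathfrak g_1,\mathfrak g_2)$ with $\mathfrak g_1=\mathfrak g_2=\mathbb{R}$ can be exponentiated to a matched pair of (real) Lie groups $(G_1,G_2)$, where each of $G_1,G_2$ is either $(\mathbb{R},+)$ or $(\mathbb{R}\setminus\{0\},\cdot)$.
   Context: Matched pair of Lie algebras (over $k=\mathbb R$ or $\mathbb C$): a pair $(\mathfrak g_1,\mathfrak g_2)$ of Lie subalgebras of a Lie algebra $\mathfrak{g}$ over $k$ such that $\mathfrak{g}=\mathfrak{g}_1\oplus\mathfrak{g}_2$ as vector spaces; the ambient $\mathfrak g$ is part of the data. Two matched pairs are isomorphic if there is an isomorphism of the ambient Lie algebras $\mathfrak g\to\mathfrak g'$ sending $\mathfrak g_i$ onto $\mathfrak g'_i$ ($i=1,2$). Matched pair of Lie groups: $G$ is a Lie group over $k$, $G_1,G_2$ are groups with a homomorphism $i:G_1\to G$ and an anti-homomorphism $j:G_2\to G$, both with closed image and homeomorphisms onto their images, $i(G_1)\cap j(G_2)=\{e\}$, and the complement of $i(G_1)j(G_2)$ in $G$ has measure zero. Its matched pair of Lie algebras consists of the Lie subalgebras of ${\rm Lie}(G)$ tangent to $i(G_1)$ and $j(G_2)$. A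 matched pair of Lie algebras can be exponentiated to $(G_1,G_2)$ if the matched pair of Lie algebras of $(G_1,G_2)$ is isomorphic to it (complex Lie groups for $k=\mathbb C$, real ones for $k=\mathbb R$). *)

theory Defs
  imports "HOL-Analysis.Analysis" "HOL-Algebra.Group"
begin

section \<open>Matched pairs of Lie algebras\<close>

locale lie_algebra = vector_space scale
  for scale :: "'k::field \<Rightarrow> 'g::ab_group_add \<Rightarrow> 'g" +
  fixes bracket :: "'g \<Rightarrow> 'g \<Rightarrow> 'g"
  assumes bracket_linear_left: "Vector_Spaces.linear scale scale (\<lambda>x. bracket x y)"
    and bracket_linear_right: "Vector_Spaces.linear scale scale (bracket x)"
    and bracket_alternating: "bracket x x = 0"
    and jacobi: "bracket x (bracket y z) + bracket y (bracket z x) + bracket z (bracket x y) = 0"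
begin

definition lie_subalgebra :: "'g set \<Rightarrow> bool" where
  "lie_subalgebra h \<longleftrightarrow> subspace h \<and> (\<forall>x\<in>h. \<forall>y\<in>h. bracket x y \<in> h)"

end

locale lie_algebra_matched_pair = lie_algebra scale bracket
  for scale :: "'k::field \<Rightarrow> 'g::ab_group_add \<Rightarrow> 'g" and bracket +
  fixes g1 g2 :: "'g set"
  assumes subalgebra_1: "lie_subalgebra g1"
    and subalgebra_2: "lie_subalgebra g2"
    and sum_eq: "{x + y | x y. x \<in> g1 \<and> y \<in> g2} = UNIV"
    and inter_eq: "g1 \<inter> g2 = {0}"

definition matched_pair_iso ::
  "('k::field \<Rightarrow> 'g::ab_group_add \<Rightarrow> 'g) \<Rightarrow> ('g \<Rightarrow> 'g \<Rightarrow> 'g) \<Rightarrow> 'g set \<Rightarrow> 'g set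
    \<Rightarrow> ('k \<Rightarrow> 'h::ab_group_add \<Rightarrow> 'h) \<Rightarrow> ('h \<Rightarrow> 'h \<Rightarrow> 'h) \<Rightarrow> 'h set \<Rightarrow> 'h set \<Rightarrow> bool" where
  "matched_pair_iso s b g1 g2 s' b' h1 h2 \<longleftrightarrow>
    (\<exists>f. Vector_Spaces.linear s s' f \<and> bij f \<and> (\<forall>x y. f (b x y) = b' (f x) (f y))
       \<and> f ` g1 = h1 \<and> f ` g2 = h2)"


section \<open>Smooth maps over the real or the complex field\<close>

text \<open>
  For an open set \<open>S\<close> and finite-dimensional spaces, \<open>Ck_on r sx sy f S\<close> says that \<open>f\<close> is \<open>r\<close> times
  continuously differentiable over the scalar field \<open>'k\<close> that acts through \<open>sx\<close> and \<open>sy\<close>: all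
  derivatives have to be \<open>'k\<close>-linear. Over the reals linearity is automatic and \<open>smooth_on\<close> is the
  usual notion of a map of class C-infinity; over the complex numbers the derivatives are
  complex linear and \<open>smooth_on\<close> means holomorphic.
\<close>

primrec Ck_on :: "nat \<Rightarrow> ('k \<Rightarrow> 'x \<Rightarrow> 'x) \<Rightarrow> ('k \<Rightarrow> 'y \<Rightarrow> 'y)
    \<Rightarrow> ('x::real_normed_vector \<Rightarrow> 'y::real_normed_vector) \<Rightarrow> 'x set \<Rightarrow> bool" where
  "Ck_on 0 sx sy f S \<longleftrightarrow> continuous_on S f"
| "Ck_on (Suc r) sx sy f S \<longleftrightarrow>
    (\<exists>f'. (\<forall>x\<in>S. (f has_derivative f' x) (at x) \<and> (\<forall>c h. f' x (sx c h) = sy c (f' x h)))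
        \<and> (\<forall>h. Ck_on r sx sy (\<lambda>x. f' x h) S))"

definition smooth_on :: "('k \<Rightarrow> 'x \<Rightarrow> 'x) \<Rightarrow> ('k \<Rightarrow> 'y \<Rightarrow> 'y)
    \<Rightarrow> ('x::real_normed_vector \<Rightarrow> 'y::real_normed_vector) \<Rightarrow> 'x set \<Rightarrow> bool" where
  "smooth_on sx sy f S \<longleftrightarrow> (\<forall>r. Ck_on r sx sy f S)"

definition scale_prod :: "'k::times \<Rightarrow> ('k^'n) \<times> ('k^'m) \<Rightarrow> ('k^'n) \<times> ('k^'m)" where
  "scale_prod c p = (c *s fst p, c *s snd p)"


section \<open>Lie groups\<close>

text \<open>
  A Lie group modelled on \<open>'k^'n\<close>, for \<open>'k\<close> the real or the complex numbers. A chart is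
  a pair consisting of its domain and the coordinate map, whose values off the domain are irrelevant.
\<close>

record ('a, 'k, 'n) lie_group_struct = "'a monoid" +
  topo :: "'a topology"
  atlas :: "('a set \<times> ('a \<Rightarrow> 'k^'n::finite)) set"

definition chart_inv :: "'a set \<times> ('a \<Rightarrow> 'b) \<Rightarrow> 'b \<Rightarrow> 'a" where
  "chart_inv c = inv_into (fst c) (snd c)"

definition is_chart :: "'a topology \<Rightarrow> 'a set \<times> ('a \<Rightarrow> 'b::topological_space) \<Rightarrow> bool" where
  "is_chart X c \<longleftrightarrow> openin X (fst c) \<and> open (snd c ` fst c)
     \<and> homeomorphic_map (subtopology X (fst c)) (top_of_set (snd c ` fst c)) (snd c)"

definition manifold :: "'a topology \<Rightarrow>
    ('a set \<times> ('a \<Rightarrow> 'k::{real_normed_field,euclidean_space}^'n::finite)) set \<Rightarrow> bool" where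
  "manifold X A \<longleftrightarrow> Hausdorff_space X \<and> second_countable X
     \<and> (\<forall>c\<in>A. is_chart X c) \<and> (\<Union>c\<in>A. fst c) = topspace X
     \<and> (\<forall>c\<in>A. \<forall>d\<in>A. smooth_on (*s) (*s) (snd d \<circ> chart_inv c) (snd c ` (fst c \<inter> fst d)))"

definition lie_group ::
    "('a, 'k::{real_normed_field,euclidean_space}, 'n::finite) lie_group_struct \<Rightarrow> bool" where
  "lie_group G \<longleftrightarrow> group G \<and> topspace (topo G) = carrier G \<and> manifold (topo G) (atlas G)
     \<and> continuous_map (prod_topology (topo G) (topo G)) (topo G) (\<lambda>(x, y). x \<otimes>\<^bsub>G\<^esub> y)
     \<and> continuous_map (topo G) (topo G) (\<lambda>x. inv\<^bsub>G\<^esub> x)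
     \<and> (\<forall>c\<in>atlas G. \<forall>d\<in>atlas G. \<forall>e\<in>atlas G.
          smooth_on scale_prod (*s) (\<lambda>(u, v). snd e (chart_inv c u \<otimes>\<^bsub>G\<^esub> chart_inv d v))
            {(snd c x, snd d y) | x y. x \<in> fst c \<and> y \<in> fst d \<and> x \<otimes>\<^bsub>G\<^esub> y \<in> fst e})
     \<and> (\<forall>c\<in>atlas G. \<forall>d\<in>atlas G.
          smooth_on (*s) (*s) (\<lambda>u. snd d (inv\<^bsub>G\<^esub> (chart_inv c u)))
            (snd c ` {x \<in> fst c. inv\<^bsub>G\<^esub> x \<in> fst d}))"

text \<open>
  Null sets of the smooth measure class, which are the null sets of the Haar measure.
\<close>

definition null_subset ::
    "('a, 'k::{real_normed_field,euclidean_space}, 'n::finite) lie_group_struct \<Rightarrow> 'a set \<Rightarrow> bool" where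
  "null_subset G N \<longleftrightarrow> N \<subseteq> carrier G \<and> (\<forall>c\<in>atlas G. negligible (snd c ` (N \<inter> fst c)))"


section \<open>The Lie algebra of a Lie group\<close>

text \<open>
  The Lie algebra is the tangent space at the unit, identified with \<open>'k^'n\<close> through a chosen chart
  around the unit. Another choice of the chart changes the bracket and the tangent spaces below
  by the derivative of the coordinate change, that is, by a linear isomorphism.
\<close>

definition unit_chart ::
    "('a, 'k::{real_normed_field,euclidean_space}, 'n::finite) lie_group_struct \<Rightarrow> 'a set \<times> ('a \<Rightarrow> 'k^'n)" where
  "unit_chart G = (SOME c. c \<in> atlas G \<and> \<one>\<^bsub>G\<^esub> \<in> fst c)"

definition unit_point ::
    "('a, 'k::{real_normed_field,euclidean_space}, 'n::finite) lie_group_struct \<Rightarrow> 'k^'n" where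
  "unit_point G = snd (unit_chart G) \<one>\<^bsub>G\<^esub>"

definition left_translation ::
    "('a, 'k::{real_normed_field,euclidean_space}, 'n::finite) lie_group_struct
      \<Rightarrow> 'k^'n \<Rightarrow> 'k^'n \<Rightarrow> 'k^'n" where
  "left_translation G u w =
     snd (unit_chart G) (chart_inv (unit_chart G) u \<otimes>\<^bsub>G\<^esub> chart_inv (unit_chart G) w)"

text \<open>
  \<open>left_inv_field G v\<close> is the left invariant vector field with value \<open>v\<close> at the unit, in coordinates.
\<close>

definition left_inv_field ::
    "('a, 'k::{real_normed_field,euclidean_space}, 'n::finite) lie_group_struct
      \<Rightarrow> 'k^'n \<Rightarrow> 'k^'n \<Rightarrow> 'k^'n" where
  "left_inv_field G v u = frechet_derivative (left_translation G u) (at (unit_point G)) v"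

text \<open>
  The commutator of vector fields \<open>X\<close>, \<open>Y\<close>, acting as derivations, has coordinates \<open>DY(X) - DX(Y)\<close>.
\<close>

definition field_bracket :: "('e::real_normed_vector \<Rightarrow> 'e) \<Rightarrow> ('e \<Rightarrow> 'e) \<Rightarrow> 'e \<Rightarrow> 'e" where
  "field_bracket X Y u = frechet_derivative Y (at u) (X u) - frechet_derivative X (at u) (Y u)"

definition Lie_bracket ::
    "('a, 'k::{real_normed_field,euclidean_space}, 'n::finite) lie_group_struct
      \<Rightarrow> 'k^'n \<Rightarrow> 'k^'n \<Rightarrow> 'k^'n" where
  "Lie_bracket G v w = field_bracket (left_inv_field G v) (left_inv_field G w) (unit_point G)"

text \<open>
  Velocities at the unit of the smooth curves (with real parameter) that run inside \<open>H\<close>; for a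
  closed subgroup \<open>H\<close> of \<open>G\<close> this is the Lie subalgebra tangent to \<open>H\<close>.
\<close>

definition tangent_at_unit ::
    "('a, 'k::{real_normed_field,euclidean_space}, 'n::finite) lie_group_struct \<Rightarrow> 'a set \<Rightarrow> ('k^'n) set" where
  "tangent_at_unit G H = {v. \<exists>\<gamma> \<epsilon>. 0 < \<epsilon> \<and> \<gamma> 0 = \<one>\<^bsub>G\<^esub>
     \<and> \<gamma> ` {-\<epsilon><..<\<epsilon>} \<subseteq> H \<inter> fst (unit_chart G)
     \<and> smooth_on scaleR scaleR (snd (unit_chart G) \<circ> \<gamma>) {-\<epsilon><..<\<epsilon>}
     \<and> ((snd (unit_chart G) \<circ> \<gamma>) has_vector_derivative v) (at (0::real))}"


section \<open>Matched pairs of Lie groups\<close>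

definition lie_group_matched_pair ::
    "('a, 'k::{real_normed_field,euclidean_space}, 'n::finite) lie_group_struct
      \<Rightarrow> 'b monoid \<Rightarrow> 'b topology \<Rightarrow> ('b \<Rightarrow> 'a)
      \<Rightarrow> 'c monoid \<Rightarrow> 'c topology \<Rightarrow> ('c \<Rightarrow> 'a) \<Rightarrow> bool" where
  "lie_group_matched_pair G G1 T1 i G2 T2 j \<longleftrightarrow>
     lie_group G
     \<and> group G1 \<and> topspace T1 = carrier G1 \<and> group G2 \<and> topspace T2 = carrier G2
     \<and> i \<in> hom G1 G
     \<and> j \<in> carrier G2 \<rightarrow> carrier G
     \<and> (\<forall>x\<in>carrier G2. \<forall>y\<in>carrier G2. j (x \<otimes>\<^bsub>G2\<^esub> y) = j y \<otimes>\<^bsub>G\<^esub> j x)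
     \<and> closedin (topo G) (i ` carrier G1) \<and> embedding_map T1 (topo G) i
     \<and> closedin (topo G) (j ` carrier G2) \<and> embedding_map T2 (topo G) j
     \<and> i ` carrier G1 \<inter> j ` carrier G2 = {\<one>\<^bsub>G\<^esub>}
     \<and> null_subset G (carrier G - {i x \<otimes>\<^bsub>G\<^esub> j y | x y. x \<in> carrier G1 \<and> y \<in> carrier G2})"

definition exponentiates_to ::
    "('k \<Rightarrow> 'g::ab_group_add \<Rightarrow> 'g) \<Rightarrow> ('g \<Rightarrow> 'g \<Rightarrow> 'g) \<Rightarrow> 'g set \<Rightarrow> 'g set
      \<Rightarrow> ('a, 'k::{real_normed_field,euclidean_space}, 'n::finite) lie_group_struct
      \<Rightarrow> 'b monoid \<Rightarrow> 'b topology \<Rightarrow> ('b \<Rightarrow> 'a)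
      \<Rightarrow> 'c monoid \<Rightarrow> 'c topology \<Rightarrow> ('c \<Rightarrow> 'a) \<Rightarrow> bool" where
  "exponentiates_to sc bracket g1 g2 G G1 T1 i G2 T2 j \<longleftrightarrow>
     lie_group_matched_pair G G1 T1 i G2 T2 j
     \<and> matched_pair_iso (*s) (Lie_bracket G)
          (tangent_at_unit G (i ` carrier G1)) (tangent_at_unit G (j ` carrier G2))
          sc bracket g1 g2"

definition additive_group :: "'k::field monoid" where
  "additive_group = \<lparr>carrier = UNIV, monoid.mult = (+), one = 0\<rparr>"

definition multiplicative_group :: "'k::field monoid" where
  "multiplicative_group = \<lparr>carrier = UNIV - {0}, monoid.mult = (*), one = 1\<rparr>"

text \<open>
  \<open>G1\<close> and \<open>G2\<close> carry the topology inherited from \<open>'k\<close>. A type for the underlying set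
  of \<open>G\<close> has to be fixed. The choice of \<open>'k^2\<close> loses nothing: a second countable Lie group has at
  most as many elements as \<open>'k^2\<close>, so its structure can be transported to a subset of \<open>'k^2\<close>. (Neither
  the topology nor the charts of \<open>G\<close> need to be related to those of \<open>'k^2\<close>.) The model space is \<open>'k^2\<close>
  because the Lie algebra of \<open>G\<close>, being the sum of two lines, has dimension 2.
\<close>

definition exponentiates_to_add_or_mult ::
    "('k::{real_normed_field,euclidean_space} \<Rightarrow> 'g::ab_group_add \<Rightarrow> 'g) \<Rightarrow> ('g \<Rightarrow> 'g \<Rightarrow> 'g)
      \<Rightarrow> 'g set \<Rightarrow> 'g set \<Rightarrow> bool" where
  "exponentiates_to_add_or_mult sc bracket g1 g2 \<longleftrightarrow>
     (\<exists>(G :: ('k^2, 'k, 2) lie_group_struct) (G1 :: 'k monoid) (G2 :: 'k monoid) i j.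
        G1 \<in> {additive_group, multiplicative_group} \<and> G2 \<in> {additive_group, multiplicative_group}
        \<and> exponentiates_to sc bracket g1 g2 G
             G1 (top_of_set (carrier G1)) i G2 (top_of_set (carrier G2)) j)"

end

theory Submission
  imports Defs
begin

text \<open>
  A linear functional \<open>l\<close> on \<open>k^n\<close> turns \<open>U = {u. 1 + l u \<noteq> 0}\<close> into a Lie group with
  \<open>u w = u + (1 + l u) w\<close>, since \<open>u \<mapsto> 1 + l u\<close> is multiplicative. Its bracket is
  \<open>[v, w] = l v w - l w v\<close>, and for \<open>n = 2\<close> every Lie bracket has this form. The line \<open>k e\<close> meets \<open>U\<close>
  in a closed subgroup tangent to it, isomorphic to the additive group if \<open>l e = 0\<close> and to the
  multiplicative group (by \<open>s e \<mapsto> 1 + s l e\<close>) otherwise. The products of elements of the two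
  coordinate lines exhaust \<open>U\<close> up to the affine hyperplane \<open>1 + l e1 u1 = 0\<close>. This covers the
  abelian and all non-abelian cases over both fields at once.
\<close>

section \<open>Maps of class C-infinity over the scalar field\<close>

text \<open>Since \<open>S\<close> is open, derivatives at its points see only values on
  \<open>S\<close>. The same family \<open>f'\<close> therefore serves \<open>g\<close>, and all
  higher-order conditions carry over without induction.\<close>

lemma Ck_on_cong:
  assumes "open S" "\<And>x. x \<in> S \<Longrightarrow> f x = g x" "Ck_on r sx sy f S"
  shows "Ck_on r sx sy g S"
proof (cases r)
  case 0
  then show ?thesis using assms by (auto cong: continuous_on_cong)
next
  case (Suc m)
  then obtain f' where f': "\<And>x. x \<in> S \<Longrightarrow> (f has_derivative f' x) (at x)"
    "\<And>x c h. x \<in> S \<Longrightarrow> f' x (sx c h) = sy c (f' x h)" "\<And>h. Ck_on m sx sy (\<lambda>x. f' x h) S"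
    using assms(3) by auto
  have "(g has_derivative f' x) (at x)" if "x \<in> S" for x
    using f'(1)[OF that] assms(1) that assms(2) by (rule has_derivative_transform_within_open)
  then show ?thesis using f' Suc by (auto intro!: exI[of _ f'])
qed

lemma smooth_on_cong:
  assumes "open S" "\<And>x. x \<in> S \<Longrightarrow> f x = g x" "smooth_on sx sy f S"
  shows "smooth_on sx sy g S"
  using assms Ck_on_cong unfolding smooth_on_def by blast

lemma Ck_on_const:
  assumes "\<And>c. sy c 0 = 0"
  shows "Ck_on r sx sy (\<lambda>x. a) S"
proof (induction r arbitrary: a)
  case (Suc r)
  show ?case
    using assms Suc by (auto intro!: exI[of _ "\<lambda>_ _. 0"])
qed simp

lemma Ck_on_add:
  assumes "\<And>c x y. sy c (x + y) = sy c x + sy c y"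
  shows "Ck_on r sx sy f S \<Longrightarrow> Ck_on r sx sy g S \<Longrightarrow> Ck_on r sx sy (\<lambda>x. f x + g x) S"
proof (induction r arbitrary: f g)
  case 0
  then show ?case by (auto intro: continuous_on_add)
next
  case (Suc r)
  obtain f' where f': "\<And>x. x \<in> S \<Longrightarrow> (f has_derivative f' x) (at x)"
    "\<And>x c h. x \<in> S \<Longrightarrow> f' x (sx c h) = sy c (f' x h)" "\<And>h. Ck_on r sx sy (\<lambda>x. f' x h) S"
    using Suc.prems(1) by auto
  obtain g' where g': "\<And>x. x \<in> S \<Longrightarrow> (g has_derivative g' x) (at x)"
    "\<And>x c h. x \<in> S \<Longrightarrow> g' x (sx c h) = sy c (g' x h)" "\<And>h. Ck_on r sx sy (\<lambda>x. g' x h) S"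
    using Suc.prems(2) by auto
  show ?case
    using f' g' Suc.IH assms
    by (auto intro!: exI[of _ "\<lambda>x h. f' x h + g' x h"] has_derivative_add)
qed

text \<open>A bounded linear map is its own derivative at every point, so each directional
  derivative is constant; the homogeneity assumption supplies linearity over the scalar
  field.\<close>

lemma Ck_on_bounded_linear:
  assumes "bounded_linear f" "\<And>c x. f (sx c x) = sy c (f x)" "\<And>c. sy c 0 = 0"
  shows "Ck_on r sx sy f S"
proof (cases r)
  case 0
  then show ?thesis
    using assms(1) by (simp add: linear_continuous_on)
next
  case (Suc m)
  then show ?thesis
    using assms bounded_linear_imp_has_derivative[OF assms(1)] Ck_on_const[where sy = sy]
    by (auto intro!: exI[of _ "\<lambda>_. f"])
qed

lemma smooth_on_bounded_linear:
  assumes "bounded_linear f" "\<And>c x. f (sx c x) = sy c (f x)" "\<And>c. sy c 0 = 0"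
  shows "smooth_on sx sy f S"
  unfolding smooth_on_def by (intro allI Ck_on_bounded_linear assms)

section \<open>Auxiliary facts on topology and scalar multiplication\<close>

lemma second_countable_euclidean:
  "second_countable (euclidean :: 'a::second_countable_topology topology)"
proof -
  obtain B :: "'a set set" where B: "countable B" "topological_basis B"
    using ex_countable_basis by metis
  show ?thesis
    unfolding second_countable_def using B topological_basis_open[OF B(2)]
    by (intro exI[of _ B]) (auto elim: topological_basisE[OF B(2)])
qed

lemma scaleR_vec_eq: "r *\<^sub>R x = of_real r *s x" for x :: "'k::real_normed_field^'n"
  by (simp add: vec_eq_iff scaleR_conv_of_real[where 'a = 'k])

lemma bounded_bilinear_vector_scalar_mult:
  "bounded_bilinear ((*s) :: 'k::{real_normed_field,euclidean_space} \<Rightarrow> 'k^'n \<Rightarrow> 'k^'n)"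
  unfolding bilinear_conv_bounded_bilinear[symmetric] bilinear_def
  by (auto intro!: linearI simp: vec_eq_iff algebra_simps)

lemmas has_derivative_vector_scalar_mult =
  bounded_bilinear.FDERIV[OF bounded_bilinear_vector_scalar_mult]

lemmas continuous_on_vector_scalar_mult =
  bounded_bilinear.continuous_on[OF bounded_bilinear_vector_scalar_mult]

section \<open>The group of a linear functional\<close>

locale linear_functional =
  fixes l :: "'k::{real_normed_field,euclidean_space}^'n \<Rightarrow> 'k"
  assumes l_add: "l (u + v) = l u + l v"
    and l_scale: "l (c *s u) = c * l u"
begin

lemma bounded_linear_l: "bounded_linear l"
  unfolding linear_conv_bounded_linear[symmetric]
  by (rule linearI) (simp_all add: l_add l_scale scaleR_vec_eq scaleR_conv_of_real)

lemma l_zero [simp]: "l 0 = 0"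
  using l_scale[of 0 0] by simp

lemmas has_derivative_l [derivative_intros] = bounded_linear.has_derivative[OF bounded_linear_l]
lemmas continuous_on_l [continuous_intros] = bounded_linear.continuous_on[OF bounded_linear_l]

definition U :: "('k^'n) set" where
  "U = {u. 1 + l u \<noteq> 0}"

lemma zero_in_U [simp]: "0 \<in> U"
  by (simp add: U_def)

lemma open_U: "open U"
proof -
  have "open ((\<lambda>u. 1 + l u) -` (- {0}))"
    by (rule open_vimage) (auto intro!: continuous_intros)
  then show ?thesis by (simp add: U_def vimage_def)
qed

text \<open>The vector \<open>u\<close> stands for the affine map
  \<open>x \<mapsto> u + (1 + l u) *s x\<close>, and the product is composition of such maps;
  membership in \<open>U\<close> makes them invertible. One global identity chart makes coordinates
  and points coincide.\<close>

definition G :: "('k^'n, 'k, 'n) lie_group_struct" where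
  "G = \<lparr>carrier = U, monoid.mult = (\<lambda>u w. u + (1 + l u) *s w), one = 0,
        topo = top_of_set U, atlas = {(U, id)}\<rparr>"

lemma G_simps [simp]:
  "carrier G = U" "u \<otimes>\<^bsub>G\<^esub> w = u + (1 + l u) *s w" "\<one>\<^bsub>G\<^esub> = 0"
  "topo G = top_of_set U" "atlas G = {(U, id)}"
  by (simp_all add: G_def)

lemma l_multiplicative: "1 + l (u + (1 + l u) *s w) = (1 + l u) * (1 + l w)"
  by (simp add: l_add l_scale algebra_simps)

lemma mult_in_U: "u \<in> U \<Longrightarrow> w \<in> U \<Longrightarrow> u + (1 + l u) *s w \<in> U"
  using l_multiplicative by (simp add: U_def)

text \<open>Inverting the affine map \<open>x \<mapsto> u + (1 + l u) *s x\<close> gives translation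
  part \<open>- u / (1 + l u)\<close> and, as \<open>*\<close> in the proof confirms, the reciprocal
  linear factor.\<close>

lemma inverse_in_U:
  assumes "u \<in> U"
  shows "inverse (1 + l u) *s (- u) \<in> U"
    and "inverse (1 + l u) *s (- u) + (1 + l (inverse (1 + l u) *s (- u))) *s u = 0"
    and "u + (1 + l u) *s (inverse (1 + l u) *s (- u)) = 0"
proof -
  have ne: "1 + l u \<noteq> 0" using assms by (simp add: U_def)
  have "l (- u) = - l u" using l_scale[of "-1" u] by (simp add: vector_sneg_minus1[symmetric])
  then have *: "1 + l (inverse (1 + l u) *s (- u)) = inverse (1 + l u)"
    unfolding l_scale using ne by (simp add: field_simps)
  show "inverse (1 + l u) *s (- u) \<in> U" using * ne by (simp add: U_def)
  show "inverse (1 + l u) *s (- u) + (1 + l (inverse (1 + l u) *s (- u))) *s u = 0"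
    unfolding * by (simp add: vec_eq_iff)
  show "u + (1 + l u) *s (inverse (1 + l u) *s (- u)) = 0"
    using ne by (simp add: vec_eq_iff)
qed

lemma group_G: "group G"
proof (rule groupI)
  fix x y z assume "x \<in> carrier G" "y \<in> carrier G" "z \<in> carrier G"
  show "x \<otimes>\<^bsub>G\<^esub> y \<otimes>\<^bsub>G\<^esub> z = x \<otimes>\<^bsub>G\<^esub> (y \<otimes>\<^bsub>G\<^esub> z)"
    \<comment> \<open>Multiplicativity is applied first, while the argument of \<open>l\<close> is
      still visibly a product; the rest is componentwise ring algebra.\<close>
    by (simp only: G_simps l_multiplicative) (simp add: vec_eq_iff algebra_simps)
next
  fix x assume "x \<in> carrier G"
  then show "\<exists>y\<in>carrier G. y \<otimes>\<^bsub>G\<^esub> x = \<one>\<^bsub>G\<^esub>"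
    using inverse_in_U(1,2) by (simp only: G_simps) blast
qed (use mult_in_U in auto)

lemma inv_G: "u \<in> U \<Longrightarrow> inv\<^bsub>G\<^esub> u = inverse (1 + l u) *s (- u)"
  by (rule group.inv_equality[OF group_G]) (use inverse_in_U in auto)

lemma chart_inv_G [simp]: "u \<in> U \<Longrightarrow> chart_inv (U, id) u = u"
  by (simp add: chart_inv_def inv_into_f_eq)

lemma manifold_G: "manifold (topo G) (atlas G)"
proof -
  have "smooth_on (*s) (*s) (id \<circ> chart_inv (U, id)) U"
    by (rule smooth_on_cong[where f = "\<lambda>x. x"])
      (auto simp: open_U intro!: smooth_on_bounded_linear bounded_linear_ident)
  then show ?thesis
    using open_U
    by (auto simp: manifold_def is_chart_def Hausdorff_space_subtopology second_countable_subtopology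
        second_countable_euclidean homeomorphic_map_id subtopology_subtopology)
qed

section \<open>Smoothness of multiplication and inversion\<close>

text \<open>The product is quadratic in the pair, so its derivative in a fixed direction is a
  constant plus a bounded linear map, and no induction on the order is required.\<close>

lemma smooth_mult: "smooth_on scale_prod (*s) (\<lambda>(u, v). u + (1 + l u) *s v) S"
proof -
  let ?f = "\<lambda>p. fst p + (1 + l (fst p)) *s snd p"
  let ?f' = "\<lambda>p h. fst h + (l (fst h) *s snd p + (1 + l (fst p)) *s snd h)"
  have bl: "bounded_linear (\<lambda>p::('k^'n)\<times>('k^'n). l (fst p) *s b + l a *s snd p)" for a b
    by (auto intro!: bounded_linear_add
        bounded_bilinear.bounded_linear_left[OF bounded_bilinear_vector_scalar_mult, THEN bounded_linear_compose]
        bounded_bilinear.bounded_linear_right[OF bounded_bilinear_vector_scalar_mult, THEN bounded_linear_compose]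
        bounded_linear_l[THEN bounded_linear_compose] bounded_linear_fst bounded_linear_snd)
  have "Ck_on r scale_prod (*s) ?f S" for r
  proof (cases r)
    case 0
    have "continuous_on S ?f"
      by (intro continuous_on_add continuous_on_vector_scalar_mult continuous_on_l
          continuous_on_const continuous_on_fst continuous_on_snd continuous_on_id)
    then show ?thesis by (simp only: 0 Ck_on.simps)
  next
    case (Suc m)
    have eq: "(\<lambda>p. ?f' p h) = (\<lambda>p. (fst h + snd h) + (l (fst p) *s snd h + l (fst h) *s snd p))" for h
      by (simp add: fun_eq_iff vec_eq_iff algebra_simps)
    have "Ck_on m scale_prod (*s) (\<lambda>p. (fst h + snd h) + (l (fst p) *s snd h + l (fst h) *s snd p)) S" for h
      by (rule Ck_on_add[OF _ Ck_on_const Ck_on_bounded_linear[OF bl]])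
        (auto simp: scale_prod_def l_scale vec_eq_iff algebra_simps)
    then have ck: "Ck_on m scale_prod (*s) (\<lambda>p. ?f' p h) S" for h
      by (simp only: eq)
    have der: "(?f has_derivative ?f' p) (at p)" for p
      by (auto intro!: derivative_eq_intros has_derivative_vector_scalar_mult simp: algebra_simps)
    have lin: "?f' p (scale_prod c h) = c *s ?f' p h" for p c h
      by (simp add: scale_prod_def l_scale vec_eq_iff algebra_simps)
    show ?thesis
      unfolding Suc Ck_on.simps by (intro exI[of _ ?f'] conjI ballI allI der lin ck)
  qed
  then show ?thesis by (simp only: smooth_on_def case_prod_unfold simp_thms)
qed

lemma has_derivative_inverse_power:
  assumes "u \<in> U"
  shows "((\<lambda>u. inverse (1 + l u) ^ n) has_derivative
    (\<lambda>h. - of_nat n * l h * inverse (1 + l u) ^ Suc n)) (at u)"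
proof -
  have ne: "1 + l u \<noteq> 0" using assms by (simp add: U_def)
  have "((\<lambda>u. 1 + l u) has_derivative l) (at u)"
    using has_derivative_add[OF has_derivative_const bounded_linear_imp_has_derivative[OF bounded_linear_l]]
    by simp
  from has_derivative_power[OF Deriv.has_derivative_inverse[OF ne this], of n]
  show ?thesis
    \<comment> \<open>The power rule produces the truncated exponent \<open>n - 1\<close>, hence the
      split on \<open>n\<close>.\<close>
    by (rule has_derivative_eq_rhs) (cases n; simp add: fun_eq_iff algebra_simps)
qed

text \<open>Functions of this shape are closed under directional differentiation up to sums: the
  derivative is a sum of two of them, with exponents \<open>n\<close> and \<open>Suc n\<close>. The
  induction on \<open>r\<close> therefore keeps \<open>n\<close>, \<open>f\<close> and
  \<open>b\<close> arbitrary.\<close>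

lemma Ck_on_inverse_power:
  assumes "bounded_linear f" "\<And>c x. f (c *s x) = c *s (f x)"
  shows "Ck_on r (*s) (*s) (\<lambda>u. inverse (1 + l u) ^ n *s (f u + b)) U"
  using assms
proof (induction r arbitrary: n f b)
  case 0
  then show ?case
    by (auto simp: U_def intro!: continuous_intros continuous_on_vector_scalar_mult
        bounded_linear.continuous_on[of f])
next
  case (Suc r)
  let ?F = "\<lambda>u. inverse (1 + l u) ^ n *s (f u + b)"
  let ?F' = "\<lambda>u h. inverse (1 + l u) ^ n *s f h +
    (- of_nat n * l h * inverse (1 + l u) ^ Suc n) *s (f u + b)"
  have add: "f (x + y) = f x + f y" for x y
    using Suc.prems(1) by (simp add: bounded_linear.linear linear_add)
  have der: "(?F has_derivative ?F' u) (at u)" if "u \<in> U" for u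
  proof -
    have "((\<lambda>u. f u + b) has_derivative f) (at u)"
      using has_derivative_add[OF bounded_linear_imp_has_derivative[OF Suc.prems(1)] has_derivative_const]
      by simp
    from has_derivative_vector_scalar_mult[OF has_derivative_inverse_power[OF that] this]
    show "(?F has_derivative ?F' u) (at u)" .
  qed
  have lin: "?F' u (c *s h) = c *s ?F' u h" for u c h
    by (simp add: Suc.prems(2) l_scale vec_eq_iff algebra_simps)
  have ck: "Ck_on r (*s) (*s) (\<lambda>u. ?F' u h) U" for h
  proof (rule Ck_on_add)
    show "Ck_on r (*s) (*s) (\<lambda>u. inverse (1 + l u) ^ n *s f h) U"
      using Suc.IH[where f = "\<lambda>_. 0" and b = "f h"] by simp
    let ?a = "- of_nat n * l h"
    have "Ck_on r (*s) (*s) (\<lambda>u. inverse (1 + l u) ^ Suc n *s (?a *s f u + ?a *s b)) U"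
    proof (rule Suc.IH)
      show "bounded_linear (\<lambda>u. ?a *s f u)"
        using bounded_linear_compose[OF bounded_bilinear.bounded_linear_right[OF
          bounded_bilinear_vector_scalar_mult] Suc.prems(1)] .
    qed (simp add: Suc.prems(2) vec_eq_iff)
    then show "Ck_on r (*s) (*s) (\<lambda>u. (?a * inverse (1 + l u) ^ Suc n) *s (f u + b)) U"
      by (rule Ck_on_cong[OF open_U, rotated]) (simp add: vec_eq_iff algebra_simps)
  qed (simp add: vec_eq_iff algebra_simps)
  show ?case
    unfolding Ck_on.simps by (intro exI[of _ ?F'] conjI ballI allI der lin ck)
qed

lemma smooth_inverse: "smooth_on (*s) (*s) (\<lambda>u. inverse (1 + l u) *s (- u)) U"
  using Ck_on_inverse_power[where f = uminus and n = 1 and b = 0]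
  by (simp add: smooth_on_def bounded_linear_minus[OF bounded_linear_ident] vec_eq_iff)

lemma lie_group_G: "lie_group G"
proof -
  have "continuous_on (U \<times> U) (\<lambda>(u, v). u + (1 + l u) *s v)"
    unfolding case_prod_beta by (auto intro!: continuous_intros continuous_on_vector_scalar_mult)
  then have mult: "continuous_map (prod_topology (topo G) (topo G)) (topo G) (\<lambda>(x, y). x \<otimes>\<^bsub>G\<^esub> y)"
    using mult_in_U by (auto simp flip: subtopology_Times)
  have "continuous_on U (\<lambda>u. inverse (1 + l u) *s (- u))"
    by (auto simp: U_def intro!: continuous_intros continuous_on_vector_scalar_mult)
  then have inv: "continuous_map (topo G) (topo G) (\<lambda>x. inv\<^bsub>G\<^esub> x)"
    using inverse_in_U(1) by (auto simp: inv_G cong: continuous_on_cong)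
  have sm: "smooth_on scale_prod (*s)
      (\<lambda>(u, v). id (chart_inv (U, id) u \<otimes>\<^bsub>G\<^esub> chart_inv (U, id) v)) (U \<times> U)"
    by (rule smooth_on_cong[OF _ _ smooth_mult]) (auto simp: open_Times open_U)
  have si: "smooth_on (*s) (*s) (\<lambda>u. id (inv\<^bsub>G\<^esub> (chart_inv (U, id) u))) U"
    by (rule smooth_on_cong[OF _ _ smooth_inverse]) (auto simp: open_U inv_G)
  \<comment> \<open>With a single chart, closure under product and inverse turns the domains of the
    two smoothness conditions into \<open>U \<times> U\<close> and \<open>U\<close>.\<close>
  have "{(x, y) | x y. x \<in> U \<and> y \<in> U \<and> x \<otimes>\<^bsub>G\<^esub> y \<in> U} = U \<times> U"
    using mult_in_U by auto
  moreover have "{x \<in> U. inv\<^bsub>G\<^esub> x \<in> U} = U"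
    using inverse_in_U(1) by (auto simp: inv_G)
  ultimately show ?thesis
    unfolding lie_group_def using group_G manifold_G mult inv sm si
    by (simp del: G_simps(2) continuous_map_in_subtopology)
qed

section \<open>The Lie algebra of \<open>G\<close>\<close>

lemma unit_chart_G [simp]: "unit_chart G = (U, id)"
  unfolding unit_chart_def by (rule some_equality) auto

lemma unit_point_G [simp]: "unit_point G = 0"
  by (simp add: unit_point_def)

lemma left_inv_field_G:
  assumes "u \<in> U"
  shows "left_inv_field G v u = (1 + l u) *s v"
proof -
  have "((\<lambda>w. u + (1 + l u) *s w) has_derivative (\<lambda>h. (1 + l u) *s h)) (at 0)"
    by (auto intro!: derivative_eq_intros has_derivative_vector_scalar_mult)
  then have "(left_translation G u has_derivative (\<lambda>h. (1 + l u) *s h)) (at 0)"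
    \<comment> \<open>\<open>left_translation\<close> agrees with the affine formula only on
      \<open>U\<close>, where \<open>chart_inv\<close> is the identity; this suffices near
      \<open>0\<close>.\<close>
    by (rule has_derivative_transform_within_open[OF _ open_U])
      (simp_all add: left_translation_def assms)
  then show ?thesis
    by (simp add: left_inv_field_def frechet_derivative_at[symmetric])
qed

text \<open>The left invariant field \<open>(1 + l u) *s v\<close> has value \<open>v\<close> and
  derivative \<open>h \<mapsto> l h *s v\<close> at \<open>0\<close>; inserting this into
  \<open>DY(X) - DX(Y)\<close> gives the formula.\<close>

lemma Lie_bracket_G: "Lie_bracket G v w = l v *s w - l w *s v"
proof -
  have "(left_inv_field G v has_derivative (\<lambda>h. l h *s v)) (at 0)" for v
  proof (rule has_derivative_transform_within_open[OF _ open_U])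
    show "((\<lambda>u. (1 + l u) *s v) has_derivative (\<lambda>h. l h *s v)) (at 0)"
      by (auto intro!: derivative_eq_intros has_derivative_vector_scalar_mult)
  qed (simp_all add: left_inv_field_G)
  note this[THEN frechet_derivative_at, symmetric, simp]
  show ?thesis
    by (simp add: Lie_bracket_def field_bracket_def frechet_derivative_at[symmetric] left_inv_field_G)
qed

section \<open>Lines through the unit\<close>

definition line_group :: "'k^'n \<Rightarrow> 'k monoid" where
  "line_group e = (if l e = 0 then additive_group else multiplicative_group)"

text \<open>In the multiplicative case this solves \<open>z = 1 + s * l e\<close> for the parameter
  \<open>s\<close> of the point \<open>s *s e\<close>, so \<open>1\<close> goes to the unit
  \<open>0\<close>.\<close>

definition line_map :: "'k^'n \<Rightarrow> 'k \<Rightarrow> 'k^'n" where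
  "line_map e z = (if l e = 0 then z else (z - 1) / l e) *s e"

lemma group_line_group: "group (line_group e)"
proof -
  have "group (additive_group :: 'k monoid)"
    by (rule groupI) (auto simp: additive_group_def algebra_simps intro: exI[of _ "- _"])
  moreover have "group (multiplicative_group :: 'k monoid)"
    by (rule groupI)
      (auto simp: multiplicative_group_def algebra_simps intro!: bexI[of _ "inverse _"])
  ultimately show ?thesis by (simp add: line_group_def)
qed

lemma line_map_image: "line_map e ` carrier (line_group e) = U \<inter> range (\<lambda>s. s *s e)"
proof (cases "l e = 0")
  case True
  then show ?thesis
    by (auto simp: line_map_def line_group_def additive_group_def U_def l_scale)
next
  case False
  have "s *s e \<in> line_map e ` (UNIV - {0})" if "1 + s * l e \<noteq> 0" for s
    using that False by (intro image_eqI[of _ _ "1 + s * l e"]) (auto simp: line_map_def)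
  then show ?thesis
    using False by (auto simp: line_map_def line_group_def multiplicative_group_def U_def l_scale)
qed

lemma line_map_mult:
  "line_map e (x \<otimes>\<^bsub>line_group e\<^esub> y) = line_map e x \<otimes>\<^bsub>G\<^esub> line_map e y"
  by (auto simp: line_map_def line_group_def additive_group_def multiplicative_group_def l_scale
      vec_eq_iff field_simps)

text \<open>The second map of a matched pair must be an anti-homomorphism; commutativity of the line
  groups makes the homomorphism \<open>line_map e\<close> one as well.\<close>

lemma line_map_commute:
  "line_map e (x \<otimes>\<^bsub>line_group e\<^esub> y) = line_map e y \<otimes>\<^bsub>G\<^esub> line_map e x"
proof -
  have "x \<otimes>\<^bsub>line_group e\<^esub> y = y \<otimes>\<^bsub>line_group e\<^esub> x"
    by (auto simp: line_group_def additive_group_def multiplicative_group_def)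
  then show ?thesis by (simp only: line_map_mult)
qed

lemma line_map_in_U: "z \<in> carrier (line_group e) \<Longrightarrow> line_map e z \<in> U"
  using line_map_image by blast

lemma closed_line: "closed (range (\<lambda>s. s *s e))"
  for e :: "'k^'n"
proof -
  have "linear (\<lambda>s. s *s e)"
    by (rule linearI) (auto simp: vec_eq_iff algebra_simps)
  then have "subspace (range (\<lambda>s. s *s e))"
    using linear_subspace_image subspace_UNIV by blast
  then show ?thesis by (rule closed_subspace)
qed

lemma closedin_line_map: "closedin (topo G) (line_map e ` carrier (line_group e))"
  unfolding line_map_image using closed_line by (auto simp: closedin_closed)

lemma embedding_line_map:
  assumes "e \<noteq> 0"
  shows "embedding_map (top_of_set (carrier (line_group e))) (topo G) (line_map e)"
proof -
  obtain k where k: "e $ k \<noteq> 0" using assms by (auto simp: vec_eq_iff)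
  let ?C = "carrier (line_group e)" 
  \<comment> \<open>A continuous inverse: \<open>v $ k / e $ k\<close> recovers \<open>s\<close>
    from \<open>v = s *s e\<close>, and the second branch returns to the multiplicative
    parameter.\<close>
  let ?g = "\<lambda>v. if l e = 0 then v $ k / e $ k else 1 + l e * (v $ k / e $ k)"
  have "continuous_on ?C (line_map e)"
    unfolding line_map_def
    by (cases "l e = 0") (auto intro!: continuous_intros continuous_on_vector_scalar_mult)
  moreover have "continuous_on (line_map e ` ?C) ?g"
    by (cases "l e = 0") (use k in \<open>auto intro!: continuous_intros\<close>)
  moreover have "?g (line_map e z) = z" for z
    using k by (auto simp: line_map_def)
  ultimately have "homeomorphic_maps (top_of_set ?C) (top_of_set (line_map e ` ?C)) (line_map e) ?g"
    by (auto simp: homeomorphic_maps_def)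
  then have "homeomorphic_map (top_of_set ?C) (top_of_set (line_map e ` ?C)) (line_map e)"
    by (rule homeomorphic_maps_imp_map)
  moreover have "U \<inter> line_map e ` ?C = line_map e ` ?C"
    using line_map_in_U by auto
  ultimately show ?thesis
    by (simp add: embedding_map_def subtopology_subtopology)
qed

text \<open>A linear map vanishing along a curve also kills its velocity, which confines tangent
  vectors to the line. Conversely, \<open>t *\<^sub>R v\<close> stays in the line and, for small
  real \<open>t\<close>, in the open set \<open>U\<close>.\<close>

lemma tangent_line:
  assumes "e \<noteq> 0"
  shows "tangent_at_unit G (line_map e ` carrier (line_group e)) = range (\<lambda>s. s *s e)"
  (is "?T = ?L")
proof
  obtain k where k: "e $ k \<noteq> 0" using assms by (auto simp: vec_eq_iff)
  \<comment> \<open>A linear map whose kernel is exactly the line spanned by \<open>e\<close>,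
    because \<open>e $ k\<close> is nonzero.\<close>
  let ?h = "\<lambda>v. e $ k *s v - v $ k *s e"
  have bl: "bounded_linear ?h"
    unfolding linear_conv_bounded_linear[symmetric]
    by (rule linearI) (auto simp: vec_eq_iff algebra_simps)
  show "?T \<subseteq> ?L"
  proof
    fix v assume "v \<in> ?T"
    then obtain g \<epsilon> where g: "0 < \<epsilon>" "g ` {-\<epsilon><..<\<epsilon>} \<subseteq> ?L"
      "(g has_vector_derivative v) (at (0::real))"
      unfolding tangent_at_unit_def line_map_image by auto
    have zero: "?h (g t) = 0" if "t \<in> {-\<epsilon><..<\<epsilon>}" for t
    proof -
      have "g t \<in> ?L" using g(2) imageI[OF that] by (rule subsetD)
      then obtain s where "g t = s *s e" by (rule imageE)
      then show ?thesis by (simp add: vec_eq_iff)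
    qed
    have "((\<lambda>t. ?h (g t)) has_vector_derivative ?h v) (at 0)"
      by (rule bounded_linear.has_vector_derivative[OF bl g(3)])
    from has_vector_derivative_transform_within_open[OF this open_greaterThanLessThan _ zero, of "-\<epsilon>" \<epsilon>]
    have "((\<lambda>t. 0) has_vector_derivative ?h v) (at (0::real))"
      using g(1) by simp
    then have "?h v = 0"
      using vector_derivative_unique_at[OF _ has_vector_derivative_const] by metis
    then have "v = (v $ k / e $ k) *s e"
      using k by (auto simp: vec_eq_iff field_simps)
    then show "v \<in> ?L" by blast
  qed
next
  show "?L \<subseteq> ?T"
  proof
    fix v assume v: "v \<in> ?L"
    have "open ((\<lambda>t::real. t *\<^sub>R v) -` U)"
      by (intro open_vimage open_U) (auto intro!: continuous_intros)
    then obtain \<epsilon> where \<epsilon>: "0 < \<epsilon>" "ball 0 \<epsilon> \<subseteq> (\<lambda>t::real. t *\<^sub>R v) -` U"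
      using open_contains_ball by (metis scaleR_zero_left vimageI zero_in_U)
    have "t *\<^sub>R v \<in> U \<inter> ?L" if "t \<in> {-\<epsilon><..<\<epsilon>}" for t
    proof -
      have "t \<in> ball 0 \<epsilon>" using that by (auto simp: dist_real_def)
      moreover have "t *\<^sub>R v \<in> ?L" using v by (auto simp: scaleR_vec_eq)
      ultimately show ?thesis using \<epsilon>(2) by auto
    qed
    moreover have "smooth_on scaleR scaleR (\<lambda>t. t *\<^sub>R v) {-\<epsilon><..<\<epsilon>}"
      by (rule smooth_on_bounded_linear) (auto intro: bounded_linear_scaleR_left)
    moreover have "((\<lambda>t. t *\<^sub>R v) has_vector_derivative v) (at (0::real))"
      by (auto intro!: derivative_eq_intros)
    ultimately show "v \<in> ?T"
      unfolding tangent_at_unit_def line_map_image using \<epsilon>(1)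
      by (auto simp: o_def intro!: exI[of _ "\<lambda>t. t *\<^sub>R v"] exI[of _ \<epsilon>])
  qed
qed

section \<open>The null complement and the matched pair of coordinate lines\<close>

text \<open>If nonempty, the set is a translate by one of its points \<open>p\<close> of the kernel
  of \<open>l\<close>, which is a real subspace missing \<open>p\<close> and so of smaller real
  dimension.\<close>

lemma negligible_l: "negligible {u. 1 + l u = 0}"
proof (cases "{u. 1 + l u = 0} = {}")
  case True
  then show ?thesis by simp
next
  case False
  then obtain p where p: "1 + l p = 0" by auto
  let ?K = "{u. l u = 0}"
  have K: "subspace ?K"
    by (auto simp: subspace_def l_add l_scale scaleR_vec_eq)
  moreover have "p \<notin> ?K" using p by auto
  ultimately have "dim ?K < DIM('k^'n)"
    using dim_psubset[of ?K UNIV] by (metis UNIV_I dim_UNIV psubsetI span_UNIV span_eq_iff subset_UNIV)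
  then have "negligible ((+) p ` ?K)"
    by (intro negligible_translation negligible_lowdim)
  then show ?thesis
  proof (rule negligible_subset, intro subsetI)
    fix u assume "u \<in> {u. 1 + l u = 0}"
    then have "1 + l u = 0" by simp
    then have "l u = l p" using p by (metis add_left_cancel)
    then have "l (u - p) = 0" using l_add[of p "u - p"] by simp
    then show "u \<in> (+) p ` ?K" by (intro image_eqI[of _ _ "u - p"]) auto
  qed
qed

end

text \<open>Makes \<open>negligible_l\<close> available for the functional
  \<open>u \<mapsto> l e1 * u $ p\<close>, whose hyperplane contains every element of
  \<open>U\<close> that is not a product.\<close>

lemma linear_functional_scaled_nth: "linear_functional (\<lambda>u. c * u $ i)"
  by unfold_locales (auto simp: algebra_simps)

lemma (in linear_functional) lie_group_matched_pair_lines: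
  fixes e1 e2 :: "'k^'n"
  assumes UNIV2: "(UNIV :: 'n set) = {p, q}" and pq: "p \<noteq> q"
  defines "e1 \<equiv> axis p 1" and "e2 \<equiv> axis q 1"
  shows "lie_group_matched_pair G
    (line_group e1) (top_of_set (carrier (line_group e1))) (line_map e1)
    (line_group e2) (top_of_set (carrier (line_group e2))) (line_map e2)"
proof -
  have ne: "e1 \<noteq> 0" "e2 \<noteq> 0" by (auto simp: e1_def e2_def axis_eq_0_iff)
  have nth [simp]: "e1 $ p = 1" "e1 $ q = 0" "e2 $ p = 0" "e2 $ q = 1"
    using pq by (auto simp: e1_def e2_def axis_def)
  have eqI: "u = v" if "u $ p = v $ p" "u $ q = v $ q" for u v :: "'k^'n"
  proof -
    have "i = p \<or> i = q" for i using UNIV2 by blast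
    then have "u $ i = v $ i" for i using that by (cases "i = p") auto
    then show ?thesis by (simp add: vec_eq_iff)
  qed
  have "u = 0" if "u \<in> range (\<lambda>s. s *s e1)" "u \<in> range (\<lambda>s. s *s e2)" for u
  proof (rule eqI)
    show "u $ p = 0 $ p" using that(2) by auto
    show "u $ q = 0 $ q" using that(1) by auto
  qed
  moreover have "0 \<in> range (\<lambda>s. s *s e)" for e :: "'k^'n"
    by (rule range_eqI[of _ _ 0]) simp
  ultimately have inter: "line_map e1 ` carrier (line_group e1) \<inter> line_map e2 ` carrier (line_group e2) = {0}"
    unfolding line_map_image using zero_in_U by blast
  let ?P = "{line_map e1 x \<otimes>\<^bsub>G\<^esub> line_map e2 y | x y. x \<in> carrier (line_group e1) \<and> y \<in> carrier (line_group e2)}"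
  have mem: "u \<in> ?P" if u: "u \<in> U" and c: "1 + l e1 * u $ p \<noteq> 0" for u
  proof -
    \<comment> \<open>Found by solving \<open>u = s *s e1 + (1 + s * l e1) *s (t *s e2)\<close> by
      coordinates; \<open>c\<close> permits the division.\<close>
    let ?s = "u $ p" and ?t = "u $ q / (1 + l e1 * u $ p)"
    have ts: "u = ?s *s e1 + (1 + l (?s *s e1)) *s (?t *s e2)"
      by (rule eqI) (use c in \<open>auto simp: l_scale mult.commute\<close>)
    have 1: "?s *s e1 \<in> U" using c by (simp add: U_def l_scale mult.commute)
    \<comment> \<open>The left side is nonzero because \<open>u\<close> lies in \<open>U\<close>, so
      the second factor is nonzero too.\<close>
    have "1 + l u = (1 + l (?s *s e1)) * (1 + l (?t *s e2))"
      by (subst ts) (rule l_multiplicative)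
    then have 2: "?t *s e2 \<in> U" using u by (auto simp: U_def)
    have "?s *s e1 \<in> line_map e1 ` carrier (line_group e1)"
      unfolding line_map_image using 1 by (intro IntI rangeI)
    then obtain x where "x \<in> carrier (line_group e1)" "line_map e1 x = ?s *s e1"
      by (metis imageE)
    moreover have "?t *s e2 \<in> line_map e2 ` carrier (line_group e2)"
      unfolding line_map_image using 2 by (intro IntI rangeI)
    then obtain y where "y \<in> carrier (line_group e2)" "line_map e2 y = ?t *s e2"
      by (metis imageE)
    ultimately have "u = line_map e1 x \<otimes>\<^bsub>G\<^esub> line_map e2 y \<and> x \<in> carrier (line_group e1) \<and> y \<in> carrier (line_group e2)"
      using ts by simp
    then show ?thesis by blast
  qed
  have "(carrier G - ?P) \<inter> U \<subseteq> {u. 1 + l e1 * u $ p = 0}"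
    using mem by blast
  then have "negligible ((carrier G - ?P) \<inter> U)"
    by (rule negligible_subset[OF linear_functional.negligible_l[OF linear_functional_scaled_nth]])
  then have "null_subset G (carrier G - ?P)"
    unfolding null_subset_def G_simps(1,5) by (simp del: G_simps(2))
  then show ?thesis
    unfolding lie_group_matched_pair_def
    using lie_group_G group_line_group closedin_line_map embedding_line_map ne inter
      line_map_in_U line_map_mult line_map_commute
    by (simp del: G_simps(2) add: hom_def Pi_iff)
qed

section \<open>From matched pairs of Lie algebras to linear functionals\<close>

lemma (in vector_space) dim_1_imp_span_singleton:
  assumes "subspace S" "dim S = 1"
  obtains x where "x \<noteq> 0" "S = range (\<lambda>c. scale c x)"
proof -
  obtain B where B: "B \<subseteq> S" "independent B" "S \<subseteq> span B" "card B = dim S"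
    using basis_exists by blast
  then obtain x where x: "B = {x}" using assms(2) by (metis card_1_singletonE)
  have "span B \<subseteq> S" using B(1) assms(1) by (rule span_minimal)
  with B(3) have "S = span {x}" using x by auto
  then have "S = range (\<lambda>c. scale c x)" by (simp add: span_singleton)
  moreover have "x \<noteq> 0" using B(2) x by simp
  ultimately show thesis using that by blast
qed

text \<open>
  With respect to spanning vectors \<open>X\<close> of \<open>g1\<close> and \<open>Y\<close> of \<open>g2\<close> write \<open>[X, Y] = a X + b Y\<close>; the
  functional with values \<open>b\<close> and \<open>-a\<close> on the two basis vectors then yields the given bracket.
\<close>

lemma exponentiates_to_add_or_mult_of_dim_1:
  fixes sc :: "'k::{real_normed_field,euclidean_space} \<Rightarrow> 'g::ab_group_add \<Rightarrow> 'g"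
  assumes "lie_algebra_matched_pair sc bracket g1 g2"
    and dims: "vector_space.dim sc g1 = 1" "vector_space.dim sc g2 = 1"
  shows "exponentiates_to_add_or_mult sc bracket g1 g2"
proof -
  interpret lie_algebra_matched_pair sc bracket g1 g2 by fact
  obtain X where X: "X \<noteq> 0" "g1 = range (\<lambda>c. sc c X)"
    using dim_1_imp_span_singleton dims(1) subalgebra_1 lie_subalgebra_def by blast
  obtain Y where Y: "Y \<noteq> 0" "g2 = range (\<lambda>c. sc c Y)"
    using dim_1_imp_span_singleton dims(2) subalgebra_2 lie_subalgebra_def by blast
  have sum: "\<exists>c d. z = sc c X + sc d Y" for z
    using sum_eq X(2) Y(2) by blast
  then obtain a b where ab: "bracket X Y = sc a X + sc b Y" by blast
  define l :: "'k^2 \<Rightarrow> 'k" where "l u = b * u $ 1 - a * u $ 2" for u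
  interpret L: linear_functional l
    by unfold_locales (auto simp: l_def algebra_simps)
  define f :: "'k^2 \<Rightarrow> 'g" where "f u = sc (u $ 1) X + sc (u $ 2) Y" for u
  interpret f: Vector_Spaces.linear "(*s)" sc f
    by unfold_locales (simp_all add: f_def scale_left_distrib scale_right_distrib)
  interpret bl: Vector_Spaces.linear sc sc "\<lambda>x. bracket x y" for y by (rule bracket_linear_left)
  interpret br: Vector_Spaces.linear sc sc "bracket x" for x by (rule bracket_linear_right)
  \<comment> \<open>A linear relation between \<open>X\<close> and \<open>Y\<close> would place
    \<open>sc c X\<close> in the trivial intersection of \<open>g1\<close> and
    \<open>g2\<close>.\<close>
  have "c = 0 \<and> d = 0" if "sc c X + sc d Y = 0" for c d
  proof -
    have "sc c X = sc (- d) Y" using that by (simp add: eq_neg_iff_add_eq_0)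
    then have "sc c X \<in> g1 \<inter> g2" unfolding X(2) Y(2) by (metis IntI rangeI)
    then have "sc c X = 0" using inter_eq by simp
    with that show ?thesis using X(1) Y(1) by simp
  qed
  then have "inj f"
    by (auto simp: f.inj_iff_eq_0 f_def vec_eq_iff forall_2)
  moreover have "surj f"
  proof -
    have "z \<in> range f" for z
    proof -
      obtain c d where "z = sc c X + sc d Y" using sum by blast
      then have "z = f (vector [c, d])" by (simp add: f_def)
      then show ?thesis by blast
    qed
    then show ?thesis by blast
  qed
  ultimately have "bij f" by (simp add: bij_def)
  have YX: "bracket Y X = - bracket X Y"
  proof -
    have "bracket (X + Y) (X + Y) = bracket X Y + bracket Y X"
      unfolding bl.add br.add by (simp add: bracket_alternating)
    then show ?thesis by (simp add: bracket_alternating eq_neg_iff_add_eq_0 add.commute)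
  qed
  \<comment> \<open>On the coordinate vectors, \<open>l e1 = b\<close> and \<open>l e2 = - a\<close>
    give \<open>[e1, e2] = b e2 + a e1\<close>, which \<open>f\<close> sends to
    \<open>[X, Y]\<close>; bilinearity and antisymmetry give the rest.\<close>
  have hom: "f (Lie_bracket L.G u v) = bracket (f u) (f v)" for u v
    by (simp add: L.Lie_bracket_G f_def l_def bl.add br.add bl.scale br.scale bracket_alternating YX ab
        scale_right_distrib scale_left_distrib scale_left_diff_distrib algebra_simps)
  let ?e1 = "axis 1 1 :: 'k^2" and ?e2 = "axis 2 1 :: 'k^2"
  have "f ` range (\<lambda>s. s *s ?e1) = g1" "f ` range (\<lambda>s. s *s ?e2) = g2"
    by (auto simp: X(2) Y(2) f_def axis_def image_image)
  moreover have "?e1 \<noteq> 0" "?e2 \<noteq> 0" by (auto simp: axis_eq_0_iff)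
  moreover have "Vector_Spaces.linear (*s) sc f" by unfold_locales
  ultimately have "matched_pair_iso (*s) (Lie_bracket L.G)
      (tangent_at_unit L.G (L.line_map ?e1 ` carrier (L.line_group ?e1)))
      (tangent_at_unit L.G (L.line_map ?e2 ` carrier (L.line_group ?e2))) sc bracket g1 g2"
    unfolding matched_pair_iso_def using \<open>bij f\<close> hom by (auto simp: L.tangent_line)
  moreover have "(UNIV :: 2 set) = {1, 2}" using exhaust_2 by auto
  ultimately have "exponentiates_to sc bracket g1 g2 L.G
      (L.line_group ?e1) (top_of_set (carrier (L.line_group ?e1))) (L.line_map ?e1)
      (L.line_group ?e2) (top_of_set (carrier (L.line_group ?e2))) (L.line_map ?e2)"
    unfolding exponentiates_to_def using L.lie_group_matched_pair_lines by simp
  moreover have "L.line_group e \<in> {additive_group, multiplicative_group}" for e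
    by (simp add: L.line_group_def)
  ultimately show ?thesis
    unfolding exponentiates_to_add_or_mult_def by blast
qed

theorem proposition3p4:
  fixes scaleC :: "complex \<Rightarrow> 'g::ab_group_add \<Rightarrow> 'g"
    and scaleR' :: "real \<Rightarrow> 'h::ab_group_add \<Rightarrow> 'h"
  shows "(\<forall>bracket g1 g2. lie_algebra_matched_pair scaleC bracket g1 g2
            \<and> vector_space.dim scaleC g1 = 1 \<and> vector_space.dim scaleC g2 = 1
            \<longrightarrow> exponentiates_to_add_or_mult scaleC bracket g1 g2)
       \<and> (\<forall>bracket g1 g2. lie_algebra_matched_pair scaleR' bracket g1 g2
            \<and> vector_space.dim scaleR' g1 = 1 \<and> vector_space.dim scaleR' g2 = 1
            \<longrightarrow> exponentiates_to_add_or_mult scaleR' bracket g1 g2)"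
  using exponentiates_to_add_or_mult_of_dim_1[of scaleC] exponentiates_to_add_or_mult_of_dim_1[of scaleR'] by blast

end
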